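(* Any Hamiltonian prelinear cancellative residuated lattice is semilinear.
   Context: A residuated lattice is an algebra $\mathbf{L}=\langle L,\wedge,\vee,\cdot,\backslash,/,\mathrm{e}\rangle$ such that $\langle L,\cdot,\mathrm{e}\rangle$ is a monoid, $\langle L,\wedge,\vee\rangle$ is a lattice, and for all $a,b,d\in L$: $ab\le d \iff a\le d/b \iff b\le a\backslash d$. It is cancellative if its monoid reduct is a cancellative monoid. It is prelinear if it satisfies both $(x\backslash y\wedge \mathrm{e})\vee(y\backslash x\wedge \mathrm{e})\approx \mathrm{e}$ and $(x/y\wedge \mathrm{e})\vee(y/x\wedge \mathrm{e})\approx \mathrm{e}$ (residuals bind more strongly than $\wedge,\vee$). For $a,b\in L$ put $\lambda_b(a)=(b\backslash ab)\wedge \mathrm{e}$ and $\rho_b(a)=(ba/b)\wedge \mathrm{e}$. A convex subuniverse of $\mathbf{L}$ is a subuniverse (subset closed under all operations) that is order-convex; a convex subuniverse $H$ is normal if $\lambda_b(a)\in H$ and $\rho_b(a)\in H$ for all $a\in H$, $b\in L$. $\mathbf{L}$ is Hamiltonian if every convex subuniverse of $\mathbf{L}$ is normal. $\mathbf{L}$ is semilinear if it is (isomorphic to) a subdirect product of totally ordered residuated lattices. *)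

theory Defs
  imports "HOL-Algebra.Divisibility" "HOL-Library.FuncSet"
begin

no_notation Lattice.join (infixl \<open>\<squnion>\<index>\<close> 65)
no_notation Lattice.meet (infixl \<open>\<sqinter>\<index>\<close> 70)

text \<open>
  \<open>x \<setminus> y\<close> and \<open>x \<oslash> y\<close> are the left and right residuals, usually written with a
  backslash and a slash.  They bind more strongly than meet and join, and less strongly than
  the product.
\<close>

record 'a rlat = "'a monoid" +
  rl_meet :: "['a, 'a] \<Rightarrow> 'a" (infixl \<open>\<sqinter>\<index>\<close> 65)
  rl_join :: "['a, 'a] \<Rightarrow> 'a" (infixl \<open>\<squnion>\<index>\<close> 65)
  ldiv :: "['a, 'a] \<Rightarrow> 'a" (infixl \<open>\<setminus>\<index>\<close> 68)
  rdiv :: "['a, 'a] \<Rightarrow> 'a" (infixl \<open>\<oslash>\<index>\<close> 68)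

definition rl_le :: "('a, 'm) rlat_scheme \<Rightarrow> 'a \<Rightarrow> 'a \<Rightarrow> bool" (infix \<open>\<preceq>\<index>\<close> 50)
  where "x \<preceq>\<^bsub>L\<^esub> y \<longleftrightarrow> x \<sqinter>\<^bsub>L\<^esub> y = x"

locale residuated_lattice = monoid L for L (structure) +
  assumes meet_closed: "\<lbrakk>x \<in> carrier L; y \<in> carrier L\<rbrakk> \<Longrightarrow> x \<sqinter> y \<in> carrier L"
    and join_closed: "\<lbrakk>x \<in> carrier L; y \<in> carrier L\<rbrakk> \<Longrightarrow> x \<squnion> y \<in> carrier L"
    and ldiv_closed: "\<lbrakk>x \<in> carrier L; y \<in> carrier L\<rbrakk> \<Longrightarrow> x \<setminus> y \<in> carrier L"
    and rdiv_closed: "\<lbrakk>x \<in> carrier L; y \<in> carrier L\<rbrakk> \<Longrightarrow> x \<oslash> y \<in> carrier L"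
    and meet_comm: "\<lbrakk>x \<in> carrier L; y \<in> carrier L\<rbrakk> \<Longrightarrow> x \<sqinter> y = y \<sqinter> x"
    and join_comm: "\<lbrakk>x \<in> carrier L; y \<in> carrier L\<rbrakk> \<Longrightarrow> x \<squnion> y = y \<squnion> x"
    and meet_assoc: "\<lbrakk>x \<in> carrier L; y \<in> carrier L; z \<in> carrier L\<rbrakk>
      \<Longrightarrow> (x \<sqinter> y) \<sqinter> z = x \<sqinter> (y \<sqinter> z)"
    and join_assoc: "\<lbrakk>x \<in> carrier L; y \<in> carrier L; z \<in> carrier L\<rbrakk>
      \<Longrightarrow> (x \<squnion> y) \<squnion> z = x \<squnion> (y \<squnion> z)"
    and meet_absorb: "\<lbrakk>x \<in> carrier L; y \<in> carrier L\<rbrakk> \<Longrightarrow> x \<sqinter> (x \<squnion> y) = x"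
    and join_absorb: "\<lbrakk>x \<in> carrier L; y \<in> carrier L\<rbrakk> \<Longrightarrow> x \<squnion> (x \<sqinter> y) = x"
    and rdiv_residual: "\<lbrakk>a \<in> carrier L; b \<in> carrier L; d \<in> carrier L\<rbrakk>
      \<Longrightarrow> a \<otimes> b \<preceq> d \<longleftrightarrow> a \<preceq> d \<oslash> b"
    and ldiv_residual: "\<lbrakk>a \<in> carrier L; b \<in> carrier L; d \<in> carrier L\<rbrakk>
      \<Longrightarrow> a \<otimes> b \<preceq> d \<longleftrightarrow> b \<preceq> a \<setminus> d"

definition prelinear :: "('a, 'm) rlat_scheme \<Rightarrow> bool"
  where "prelinear L \<longleftrightarrow> (\<forall>x\<in>carrier L. \<forall>y\<in>carrier L.
    (x \<setminus>\<^bsub>L\<^esub> y \<sqinter>\<^bsub>L\<^esub> \<one>\<^bsub>L\<^esub>) \<squnion>\<^bsub>L\<^esub> (y \<setminus>\<^bsub>L\<^esub> x \<sqinter>\<^bsub>L\<^esub> \<one>\<^bsub>L\<^esub>) = \<one>\<^bsub>L\<^esub> \<and>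
    (x \<oslash>\<^bsub>L\<^esub> y \<sqinter>\<^bsub>L\<^esub> \<one>\<^bsub>L\<^esub>) \<squnion>\<^bsub>L\<^esub> (y \<oslash>\<^bsub>L\<^esub> x \<sqinter>\<^bsub>L\<^esub> \<one>\<^bsub>L\<^esub>) = \<one>\<^bsub>L\<^esub>)"

definition lconj :: "('a, 'm) rlat_scheme \<Rightarrow> 'a \<Rightarrow> 'a \<Rightarrow> 'a"
  where "lconj L b a = (b \<setminus>\<^bsub>L\<^esub> (a \<otimes>\<^bsub>L\<^esub> b)) \<sqinter>\<^bsub>L\<^esub> \<one>\<^bsub>L\<^esub>"

definition rconj :: "('a, 'm) rlat_scheme \<Rightarrow> 'a \<Rightarrow> 'a \<Rightarrow> 'a"
  where "rconj L b a = ((b \<otimes>\<^bsub>L\<^esub> a) \<oslash>\<^bsub>L\<^esub> b) \<sqinter>\<^bsub>L\<^esub> \<one>\<^bsub>L\<^esub>"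

definition subuniverse :: "'a set \<Rightarrow> ('a, 'm) rlat_scheme \<Rightarrow> bool"
  where "subuniverse H L \<longleftrightarrow> H \<subseteq> carrier L \<and> \<one>\<^bsub>L\<^esub> \<in> H \<and>
    (\<forall>x\<in>H. \<forall>y\<in>H. x \<otimes>\<^bsub>L\<^esub> y \<in> H \<and> x \<sqinter>\<^bsub>L\<^esub> y \<in> H \<and> x \<squnion>\<^bsub>L\<^esub> y \<in> H \<and>
      x \<setminus>\<^bsub>L\<^esub> y \<in> H \<and> x \<oslash>\<^bsub>L\<^esub> y \<in> H)"

definition convex_subuniverse :: "'a set \<Rightarrow> ('a, 'm) rlat_scheme \<Rightarrow> bool"
  where "convex_subuniverse H L \<longleftrightarrow> subuniverse H L \<and>
    (\<forall>x\<in>H. \<forall>z\<in>H. \<forall>y\<in>carrier L. x \<preceq>\<^bsub>L\<^esub> y \<and> y \<preceq>\<^bsub>L\<^esub> z \<longrightarrow> y \<in> H)"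

definition normal_subuniverse :: "'a set \<Rightarrow> ('a, 'm) rlat_scheme \<Rightarrow> bool"
  where "normal_subuniverse H L \<longleftrightarrow> convex_subuniverse H L \<and>
    (\<forall>a\<in>H. \<forall>b\<in>carrier L. lconj L b a \<in> H \<and> rconj L b a \<in> H)"

definition hamiltonian :: "('a, 'm) rlat_scheme \<Rightarrow> bool"
  where "hamiltonian L \<longleftrightarrow> (\<forall>H. convex_subuniverse H L \<longrightarrow> normal_subuniverse H L)"

definition rl_hom :: "('a, 'm) rlat_scheme \<Rightarrow> ('b, 'n) rlat_scheme \<Rightarrow> ('a \<Rightarrow> 'b) set"
  where "rl_hom L M = {h \<in> hom L M. h \<one>\<^bsub>L\<^esub> = \<one>\<^bsub>M\<^esub> \<and>
    (\<forall>x\<in>carrier L. \<forall>y\<in>carrier L.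
      h (x \<sqinter>\<^bsub>L\<^esub> y) = h x \<sqinter>\<^bsub>M\<^esub> h y \<and> h (x \<squnion>\<^bsub>L\<^esub> y) = h x \<squnion>\<^bsub>M\<^esub> h y \<and>
      h (x \<setminus>\<^bsub>L\<^esub> y) = h x \<setminus>\<^bsub>M\<^esub> h y \<and> h (x \<oslash>\<^bsub>L\<^esub> y) = h x \<oslash>\<^bsub>M\<^esub> h y)}"

definition rl_isomorphic :: "('a, 'm) rlat_scheme \<Rightarrow> ('b, 'n) rlat_scheme \<Rightarrow> bool"
  where "rl_isomorphic L M \<longleftrightarrow> (\<exists>h\<in>rl_hom L M. bij_betw h (carrier L) (carrier M))"

definition totally_ordered_rl :: "('a, 'm) rlat_scheme \<Rightarrow> bool"
  where "totally_ordered_rl L \<longleftrightarrow> residuated_lattice L \<and>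
    (\<forall>x\<in>carrier L. \<forall>y\<in>carrier L. x \<preceq>\<^bsub>L\<^esub> y \<or> y \<preceq>\<^bsub>L\<^esub> x)"

definition product_rl :: "'i set \<Rightarrow> ('i \<Rightarrow> ('b, 'n) rlat_scheme) \<Rightarrow> ('i \<Rightarrow> 'b) rlat"
  where "product_rl I M = \<lparr>
    carrier = (\<Pi>\<^sub>E i\<in>I. carrier (M i)),
    monoid.mult = (\<lambda>x y. \<lambda>i\<in>I. x i \<otimes>\<^bsub>M i\<^esub> y i),
    one = (\<lambda>i\<in>I. \<one>\<^bsub>M i\<^esub>),
    rl_meet = (\<lambda>x y. \<lambda>i\<in>I. x i \<sqinter>\<^bsub>M i\<^esub> y i),
    rl_join = (\<lambda>x y. \<lambda>i\<in>I. x i \<squnion>\<^bsub>M i\<^esub> y i),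
    ldiv = (\<lambda>x y. \<lambda>i\<in>I. x i \<setminus>\<^bsub>M i\<^esub> y i),
    rdiv = (\<lambda>x y. \<lambda>i\<in>I. x i \<oslash>\<^bsub>M i\<^esub> y i)\<rparr>"

definition is_subdirect :: "('i \<Rightarrow> 'b) set \<Rightarrow> 'i set \<Rightarrow> ('i \<Rightarrow> ('b, 'n) rlat_scheme) \<Rightarrow> bool"
  where "is_subdirect S I M \<longleftrightarrow> subuniverse S (product_rl I M) \<and>
    (\<forall>i\<in>I. (\<lambda>x. x i) ` S = carrier (M i))"

text \<open>
  \<open>L\<close> is isomorphic to the subdirect product \<open>S\<close> of the chains \<open>M i\<close>.  HOL cannot quantify
  over the types of the index set and of the factors inside a formula, so
  \<open>semilinear\<close> below fixes them in terms of the element type of \<open>L\<close>;  lemma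
  \<open>semilinear_if_represented\<close> shows that this loses no generality.
\<close>

definition represents ::
    "('a, 'm) rlat_scheme \<Rightarrow> 'i set \<Rightarrow> ('i \<Rightarrow> 'b rlat) \<Rightarrow> ('i \<Rightarrow> 'b) set \<Rightarrow> bool"
  where "represents L I M S \<longleftrightarrow> (\<forall>i\<in>I. totally_ordered_rl (M i)) \<and> is_subdirect S I M \<and>
    rl_isomorphic L ((product_rl I M)\<lparr>carrier := S\<rparr>)"

definition semilinear :: "('a, 'm) rlat_scheme \<Rightarrow> bool"
  where "semilinear L \<longleftrightarrow>
    (\<exists>(I :: ('a \<times> 'a) set) (M :: 'a \<times> 'a \<Rightarrow> 'a rlat) S. represents L I M S)"

definition transport_rl :: "('b \<Rightarrow> 'a) \<Rightarrow> ('a \<Rightarrow> 'b) \<Rightarrow> 'b rlat \<Rightarrow> 'a rlat"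
  where "transport_rl g h M = \<lparr>
    carrier = g ` carrier M,
    monoid.mult = (\<lambda>x y. g (h x \<otimes>\<^bsub>M\<^esub> h y)),
    one = g \<one>\<^bsub>M\<^esub>,
    rl_meet = (\<lambda>x y. g (h x \<sqinter>\<^bsub>M\<^esub> h y)),
    rl_join = (\<lambda>x y. g (h x \<squnion>\<^bsub>M\<^esub> h y)),
    ldiv = (\<lambda>x y. g (h x \<setminus>\<^bsub>M\<^esub> h y)),
    rdiv = (\<lambda>x y. g (h x \<oslash>\<^bsub>M\<^esub> h y))\<rparr>"

lemma totally_ordered_transport:
  assumes M: "totally_ordered_rl M" and gh: "\<And>x. x \<in> carrier M \<Longrightarrow> h (g x) = x"
  shows "totally_ordered_rl (transport_rl g h M)"
proof -
  interpret residuated_lattice M using M by (simp add: totally_ordered_rl_def)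
  have inj: "g x = g y \<longleftrightarrow> x = y" if "x \<in> carrier M" "y \<in> carrier M" for x y
    using gh that by metis
  have le: "g x \<preceq>\<^bsub>transport_rl g h M\<^esub> g y \<longleftrightarrow> x \<preceq>\<^bsub>M\<^esub> y"
    if "x \<in> carrier M" "y \<in> carrier M" for x y
    using that by (simp add: transport_rl_def rl_le_def gh inj meet_closed)
  have "residuated_lattice (transport_rl g h M)"
  proof (unfold_locales, goal_cases)
    case (16 a b d)
    then obtain a' b' d' where *: "a = g a'" "b = g b'" "d = g d'" 
      "a' \<in> carrier M" "b' \<in> carrier M" "d' \<in> carrier M" by (auto simp: transport_rl_def)
    have e: "g a' \<otimes>\<^bsub>transport_rl g h M\<^esub> g b' = g (a' \<otimes>\<^bsub>M\<^esub> b')"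
      "g d' \<oslash>\<^bsub>transport_rl g h M\<^esub> g b' = g (d' \<oslash>\<^bsub>M\<^esub> b')" using * by (auto simp: transport_rl_def gh)
    show ?case unfolding * e using * by (simp add: le rdiv_closed rdiv_residual)
  next
    case (17 a b d)
    then obtain a' b' d' where *: "a = g a'" "b = g b'" "d = g d'" 
      "a' \<in> carrier M" "b' \<in> carrier M" "d' \<in> carrier M" by (auto simp: transport_rl_def)
    have e: "g a' \<otimes>\<^bsub>transport_rl g h M\<^esub> g b' = g (a' \<otimes>\<^bsub>M\<^esub> b')"
      "g a' \<setminus>\<^bsub>transport_rl g h M\<^esub> g d' = g (a' \<setminus>\<^bsub>M\<^esub> d')" using * by (auto simp: transport_rl_def gh)
    show ?case unfolding * e using * by (simp add: le ldiv_closed ldiv_residual)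
  qed (auto simp: transport_rl_def gh meet_closed join_closed ldiv_closed rdiv_closed m_assoc
        meet_assoc join_assoc meet_absorb join_absorb
        intro: arg_cong[of _ _ g, OF meet_comm] arg_cong[of _ _ g, OF join_comm])
  moreover have "x \<preceq>\<^bsub>transport_rl g h M\<^esub> y \<or> y \<preceq>\<^bsub>transport_rl g h M\<^esub> x"
    if "x \<in> carrier (transport_rl g h M)" "y \<in> carrier (transport_rl g h M)" for x y
  proof -
    obtain x' y' where "x = g x'" "y = g y'" "x' \<in> carrier M" "y' \<in> carrier M"
      using \<open>x \<in> _\<close> \<open>y \<in> _\<close> by (auto simp: transport_rl_def)
    then show ?thesis using M by (simp add: le totally_ordered_rl_def)
  qed
  ultimately show ?thesis by (simp add: totally_ordered_rl_def)
qed

lemma semilinear_if_represented: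
  fixes L :: "('a, 'm) rlat_scheme" and I :: "'i set" and M :: "'i \<Rightarrow> 'b rlat"
  assumes "residuated_lattice L" and "represents L I M S"
  shows "semilinear L"
proof -
  interpret residuated_lattice L by fact
  obtain f where f: "f \<in> rl_hom L ((product_rl I M)\<lparr>carrier := S\<rparr>)" "bij_betw f (carrier L) S"
    and M: "\<And>i. i \<in> I \<Longrightarrow> totally_ordered_rl (M i)" and S: "is_subdirect S I M"
    using assms(2) by (auto simp: represents_def rl_isomorphic_def)
  have fS: "f ` carrier L = S" using f(2) by (simp add: bij_betw_def)
  have S_sub: "S \<subseteq> (\<Pi>\<^sub>E i\<in>I. carrier (M i))"
    using S by (simp add: is_subdirect_def subuniverse_def product_rl_def)
  have f_surj: "(\<lambda>a. f a i) ` carrier L = carrier (M i)" if "i \<in> I" for i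
    using S that unfolding is_subdirect_def fS[symmetric] by (simp add: image_image)
  have f_in: "f a i \<in> carrier (M i)" if "i \<in> I" "a \<in> carrier L" for a i
    using f_surj that by blast
  define J where "J = {(a, b). a \<in> carrier L \<and> b \<in> carrier L \<and> a \<noteq> b}"
  define k where "k p = (SOME i. i \<in> I \<and> f (fst p) i \<noteq> f (snd p) i)" for p
  have k: "k p \<in> I \<and> f (fst p) (k p) \<noteq> f (snd p) (k p)" if "p \<in> J" for p
  proof -
    have p: "fst p \<in> carrier L" "snd p \<in> carrier L" "fst p \<noteq> snd p"
      using that by (auto simp: J_def)
    have ne: "f (fst p) \<noteq> f (snd p)"
      using p f(2) by (metis bij_betw_imp_inj_on inj_onD)
    have car: "f (fst p) \<in> S" "f (snd p) \<in> S"
      using p fS by blast+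
    have "\<exists>i. i \<in> I \<and> f (fst p) i \<noteq> f (snd p) i"
      using ne PiE_ext[of "f (fst p)" I "\<lambda>i. carrier (M i)" "f (snd p)"] car S_sub by blast
    then show ?thesis unfolding k_def by (rule someI_ex)
  qed
  define h where "h p a = f a (k p)" for p a
  define g where "g p = inv_into (carrier L) (h p)" for p
  define N where "N p = transport_rl (g p) (h p) (M (k p))" for p
  have h_surj: "h p ` carrier L = carrier (M (k p))" if "p \<in> J" for p
    unfolding h_def using f_surj k that by blast
  have hg: "h p (g p x) = x" if "p \<in> J" "x \<in> carrier (M (k p))" for p x
    unfolding g_def using that h_surj by (simp add: f_inv_into_f)
  have h_in: "h p a \<in> carrier (M (k p))" if "p \<in> J" "a \<in> carrier L" for p a
    using that h_surj by blast
  have h_one: "h p \<one>\<^bsub>L\<^esub> = \<one>\<^bsub>M (k p)\<^esub>" if "p \<in> J" for p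
    using f(1) k[OF that] by (auto simp: h_def rl_hom_def product_rl_def)
  have h_op: "h p (x \<otimes>\<^bsub>L\<^esub> y) = h p x \<otimes>\<^bsub>M (k p)\<^esub> h p y"
    "h p (x \<sqinter>\<^bsub>L\<^esub> y) = h p x \<sqinter>\<^bsub>M (k p)\<^esub> h p y"
    "h p (x \<squnion>\<^bsub>L\<^esub> y) = h p x \<squnion>\<^bsub>M (k p)\<^esub> h p y"
    "h p (x \<setminus>\<^bsub>L\<^esub> y) = h p x \<setminus>\<^bsub>M (k p)\<^esub> h p y"
    "h p (x \<oslash>\<^bsub>L\<^esub> y) = h p x \<oslash>\<^bsub>M (k p)\<^esub> h p y"
    if "p \<in> J" "x \<in> carrier L" "y \<in> carrier L" for p x y
    using f(1) k[OF that(1)] that(2,3) by (auto simp: h_def rl_hom_def product_rl_def hom_def)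
  define e where "e a = (\<lambda>p\<in>J. g p (h p a))" for a
  define T where "T = e ` carrier L"
  let ?P = "product_rl J N"
  have e_one: "e \<one>\<^bsub>L\<^esub> = \<one>\<^bsub>?P\<^esub>"
    by (rule ext) (simp add: e_def product_rl_def N_def transport_rl_def h_one)
  have e_op: "e (x \<otimes>\<^bsub>L\<^esub> y) = e x \<otimes>\<^bsub>?P\<^esub> e y" "e (x \<sqinter>\<^bsub>L\<^esub> y) = e x \<sqinter>\<^bsub>?P\<^esub> e y"
    "e (x \<squnion>\<^bsub>L\<^esub> y) = e x \<squnion>\<^bsub>?P\<^esub> e y" "e (x \<setminus>\<^bsub>L\<^esub> y) = e x \<setminus>\<^bsub>?P\<^esub> e y"
    "e (x \<oslash>\<^bsub>L\<^esub> y) = e x \<oslash>\<^bsub>?P\<^esub> e y"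
    if "x \<in> carrier L" "y \<in> carrier L" for x y
    using that
    by (auto simp: e_def product_rl_def N_def transport_rl_def h_op hg h_in fun_eq_iff
        restrict_def)
  have closed: "x \<otimes>\<^bsub>L\<^esub> y \<in> carrier L" "x \<sqinter>\<^bsub>L\<^esub> y \<in> carrier L" "x \<squnion>\<^bsub>L\<^esub> y \<in> carrier L"
    "x \<setminus>\<^bsub>L\<^esub> y \<in> carrier L" "x \<oslash>\<^bsub>L\<^esub> y \<in> carrier L"
    if "x \<in> carrier L" "y \<in> carrier L" for x y
    using that by (simp_all add: meet_closed join_closed ldiv_closed rdiv_closed)
  have T_car: "T \<subseteq> carrier ?P"
    by (auto simp: T_def e_def product_rl_def N_def transport_rl_def h_in)
  have T_one: "\<one>\<^bsub>?P\<^esub> \<in> T" unfolding T_def e_one[symmetric] by simp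
  have T_op: "x \<otimes>\<^bsub>?P\<^esub> y \<in> T \<and> x \<sqinter>\<^bsub>?P\<^esub> y \<in> T \<and> x \<squnion>\<^bsub>?P\<^esub> y \<in> T \<and> x \<setminus>\<^bsub>?P\<^esub> y \<in> T \<and> x \<oslash>\<^bsub>?P\<^esub> y \<in> T"
    if "x \<in> T" "y \<in> T" for x y
  proof -
    obtain a b where ab: "x = e a" "y = e b" "a \<in> carrier L" "b \<in> carrier L"
      using \<open>x \<in> T\<close> \<open>y \<in> T\<close> unfolding T_def by blast
    show ?thesis unfolding ab(1,2) e_op[OF ab(3,4), symmetric] T_def
      using closed[OF ab(3,4)] by blast
  qed
  have sub: "subuniverse T ?P" using T_car T_one T_op by (simp add: subuniverse_def)
  have proj: "(\<lambda>x. x p) ` T = carrier (N p)" if "p \<in> J" for p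
  proof -
    have "(\<lambda>x. x p) ` T = g p ` h p ` carrier L"
      using that by (simp add: T_def e_def image_image)
    then show ?thesis using h_surj[OF that] by (simp add: N_def transport_rl_def)
  qed
  have inj: "inj_on e (carrier L)"
  proof (rule inj_onI, rule ccontr)
    fix a b assume *: "a \<in> carrier L" "b \<in> carrier L" "e a = e b" "a \<noteq> b"
    then have p: "(a, b) \<in> J" by (simp add: J_def)
    have "g (a, b) (h (a, b) a) = g (a, b) (h (a, b) b)"
      using fun_cong[OF *(3), of "(a, b)"] p by (simp add: e_def)
    then have "h (a, b) a = h (a, b) b" using hg[OF p] h_in[OF p] *(1,2) by metis
    then show False using k[OF p] by (simp add: h_def)
  qed
  have hom: "e \<in> rl_hom L (?P\<lparr>carrier := T\<rparr>)"
    using e_one e_op by (simp add: rl_hom_def hom_def T_def Pi_iff)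
  have "rl_isomorphic L (?P\<lparr>carrier := T\<rparr>)"
    unfolding rl_isomorphic_def using hom inj by (auto simp: bij_betw_def T_def)
  moreover have "totally_ordered_rl (N p)" if "p \<in> J" for p
    unfolding N_def using k[OF that] M hg[OF that] by (blast intro: totally_ordered_transport)
  ultimately have "represents L J N T"
    using sub proj by (simp add: represents_def is_subdirect_def)
  then show ?thesis unfolding semilinear_def by blast
qed

end

theory Submission
  imports Defs
begin

text \<open>
  The chains that represent \<open>L\<close> are its quotients by \<^emph>\<open>prime filters\<close> of the negative cone
  \<open>{x. x \<preceq> \<one>}\<close>: submonoids \<open>F\<close> of the cone that are upward closed in it and contain \<open>c\<close> or \<open>d\<close>
  whenever \<open>c \<squnion> d = \<one>\<close>.  Such an \<open>F\<close> induces the preorder ``\<open>x \<otimes> f \<preceq> y\<close> for some \<open>f \<in> F\<close>''.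
  Prelinearity says that \<open>(x \<setminus> y) \<sqinter> \<one>\<close> and \<open>(y \<setminus> x) \<sqinter> \<one>\<close> join to \<open>\<one>\<close>, so primeness of \<open>F\<close>
  makes this preorder total.

  For the quotient to be a residuated lattice the preorder must be compatible with
  multiplication on both sides, which is the case once \<open>F\<close> is closed under the conjugations
  \<open>lconj\<close> and \<open>rconj\<close>, for then \<open>x \<otimes> f \<preceq> y\<close> can be traded for \<open>g \<otimes> x \<preceq> y\<close>.  This is what the
  Hamiltonian property provides: the set of all \<open>x\<close> with \<open>f \<preceq> x\<close> and \<open>f \<otimes> x \<preceq> \<one>\<close> for
  some \<open>f \<in> F\<close> is a convex subuniverse whose negative part is \<open>F\<close>.  To see that it
  is closed under both residuals one needs \<open>x \<otimes> y \<preceq> \<one> \<longleftrightarrow> y \<otimes> x \<preceq> \<one>\<close>, and this is a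
  consequence of cancellativity: if \<open>x \<otimes> y \<preceq> \<one>\<close> then \<open>x \<otimes> (y \<otimes> x) \<preceq> x\<close>, so
  \<open>y \<otimes> x \<preceq> x \<setminus> x = \<one>\<close>.

  Finally there are enough prime filters to separate points.  If \<open>\<not> x \<preceq> y\<close>, then
  \<open>a = (x \<setminus> y) \<sqinter> \<one>\<close> differs from \<open>\<one>\<close>, and a filter that is maximal among those avoiding \<open>a\<close> is
  prime (\<open>prime_filter_avoiding\<close>); in its quotient \<open>x\<close> is still not below \<open>y\<close>.
\<close>

section \<open>Order and multiplication in residuated lattices\<close>

context residuated_lattice
begin

lemmas closed = meet_closed join_closed ldiv_closed rdiv_closed

lemma le_refl: "x \<in> carrier L \<Longrightarrow> x \<preceq> x"
  unfolding rl_le_def by (metis meet_absorb join_absorb meet_closed)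

lemma le_antisym: "\<lbrakk>x \<in> carrier L; y \<in> carrier L; x \<preceq> y; y \<preceq> x\<rbrakk> \<Longrightarrow> x = y"
  unfolding rl_le_def by (metis meet_comm)

lemma le_trans: "\<lbrakk>x \<in> carrier L; y \<in> carrier L; z \<in> carrier L; x \<preceq> y; y \<preceq> z\<rbrakk> \<Longrightarrow> x \<preceq> z"
  unfolding rl_le_def by (metis meet_assoc)

lemma le_iff_join: "\<lbrakk>x \<in> carrier L; y \<in> carrier L\<rbrakk> \<Longrightarrow> x \<preceq> y \<longleftrightarrow> x \<squnion> y = y"
  unfolding rl_le_def by (metis meet_comm join_comm meet_absorb join_absorb)

lemma meet_le1: "\<lbrakk>x \<in> carrier L; y \<in> carrier L\<rbrakk> \<Longrightarrow> x \<sqinter> y \<preceq> x"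
  unfolding rl_le_def by (metis meet_comm meet_assoc le_refl rl_le_def)

lemma meet_le2: "\<lbrakk>x \<in> carrier L; y \<in> carrier L\<rbrakk> \<Longrightarrow> x \<sqinter> y \<preceq> y"
  by (metis meet_comm meet_le1)

lemma le_meetI:
  "\<lbrakk>x \<in> carrier L; y \<in> carrier L; z \<in> carrier L; z \<preceq> x; z \<preceq> y\<rbrakk> \<Longrightarrow> z \<preceq> x \<sqinter> y"
  unfolding rl_le_def by (metis meet_assoc)

lemma join_ge1: "\<lbrakk>x \<in> carrier L; y \<in> carrier L\<rbrakk> \<Longrightarrow> x \<preceq> x \<squnion> y"
  unfolding rl_le_def by (rule meet_absorb)

lemma join_ge2: "\<lbrakk>x \<in> carrier L; y \<in> carrier L\<rbrakk> \<Longrightarrow> y \<preceq> x \<squnion> y"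
  by (metis join_comm join_ge1)

lemma join_leI:
  "\<lbrakk>x \<in> carrier L; y \<in> carrier L; z \<in> carrier L; x \<preceq> z; y \<preceq> z\<rbrakk> \<Longrightarrow> x \<squnion> y \<preceq> z"
  by (simp add: le_iff_join closed join_assoc)

lemma mult_left_mono:
  assumes "x \<in> carrier L" "y \<in> carrier L" "z \<in> carrier L" "x \<preceq> y" shows "z \<otimes> x \<preceq> z \<otimes> y"
proof -
  have "y \<preceq> z \<setminus> (z \<otimes> y)" using assms by (simp add: ldiv_residual[symmetric] le_refl)
  then have "x \<preceq> z \<setminus> (z \<otimes> y)" using assms le_trans[of x y] by (simp add: closed)
  then show ?thesis using assms by (simp add: ldiv_residual)
qed

lemma mult_right_mono:
  assumes "x \<in> carrier L" "y \<in> carrier L" "z \<in> carrier L" "x \<preceq> y" shows "x \<otimes> z \<preceq> y \<otimes> z"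
proof -
  have "y \<preceq> (y \<otimes> z) \<oslash> z" using assms by (simp add: rdiv_residual[symmetric] le_refl)
  then have "x \<preceq> (y \<otimes> z) \<oslash> z" using assms le_trans[of x y] by (simp add: closed)
  then show ?thesis using assms by (simp add: rdiv_residual)
qed

lemma mult_mono:
  assumes "x \<in> carrier L" "x' \<in> carrier L" "y \<in> carrier L" "y' \<in> carrier L" "x \<preceq> x'" "y \<preceq> y'"
  shows "x \<otimes> y \<preceq> x' \<otimes> y'"
  using assms le_trans[of "x \<otimes> y" "x' \<otimes> y" "x' \<otimes> y'"]
  by (simp add: mult_left_mono mult_right_mono)

lemma mult_neg_right: "\<lbrakk>x \<in> carrier L; f \<in> carrier L; f \<preceq> \<one>\<rbrakk> \<Longrightarrow> x \<otimes> f \<preceq> x"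
  using mult_left_mono[of f \<one> x] by simp

lemma mult_neg_left: "\<lbrakk>x \<in> carrier L; f \<in> carrier L; f \<preceq> \<one>\<rbrakk> \<Longrightarrow> f \<otimes> x \<preceq> x"
  using mult_right_mono[of f \<one> x] by simp

lemma mult_neg_neg:
  "\<lbrakk>x \<in> carrier L; y \<in> carrier L; x \<preceq> \<one>; y \<preceq> \<one>\<rbrakk> \<Longrightarrow> x \<otimes> y \<preceq> \<one>"
  using mult_mono[of x \<one> y \<one>] by simp

lemma join_mult_leI:
  "\<lbrakk>x \<in> carrier L; y \<in> carrier L; z \<in> carrier L; w \<in> carrier L; x \<otimes> z \<preceq> w; y \<otimes> z \<preceq> w\<rbrakk>
    \<Longrightarrow> (x \<squnion> y) \<otimes> z \<preceq> w"
  by (simp add: rdiv_residual closed join_leI)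

lemma mult_join_leI:
  "\<lbrakk>x \<in> carrier L; y \<in> carrier L; z \<in> carrier L; w \<in> carrier L; z \<otimes> x \<preceq> w; z \<otimes> y \<preceq> w\<rbrakk>
    \<Longrightarrow> z \<otimes> (x \<squnion> y) \<preceq> w"
  by (simp add: ldiv_residual closed join_leI)

lemma mult_ldiv_le: "\<lbrakk>x \<in> carrier L; y \<in> carrier L\<rbrakk> \<Longrightarrow> x \<otimes> (x \<setminus> y) \<preceq> y"
  by (simp add: ldiv_residual closed le_refl)

lemma rdiv_mult_le: "\<lbrakk>x \<in> carrier L; y \<in> carrier L\<rbrakk> \<Longrightarrow> (y \<oslash> x) \<otimes> x \<preceq> y"
  by (simp add: rdiv_residual closed le_refl)

lemma pow_mono:
  "\<lbrakk>x \<in> carrier L; y \<in> carrier L; x \<preceq> y\<rbrakk> \<Longrightarrow> x [^] (n::nat) \<preceq> y [^] n"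
  by (induction n) (simp_all add: le_refl mult_mono)

lemma pow_neg: "\<lbrakk>x \<in> carrier L; x \<preceq> \<one>\<rbrakk> \<Longrightarrow> x [^] (n::nat) \<preceq> \<one>"
  using pow_mono[of x \<one> n] by simp

text \<open>
  For negative \<open>u\<close>, \<open>v\<close>, \<open>y\<close> one has \<open>(u \<squnion> y) \<otimes> (v \<squnion> y) \<preceq> (u \<otimes> v) \<squnion> y\<close>, because every product
  involving a factor \<open>y\<close> lies below \<open>y\<close>.  Iterating this replaces \<open>x\<close> by its powers.
\<close>

lemma pow_le_pow_join:
  fixes n :: nat
  assumes [simp]: "x \<in> carrier L" "y \<in> carrier L" "r \<in> carrier L"
    and neg: "x \<preceq> \<one>" "y \<preceq> \<one>" and r: "r \<preceq> x \<squnion> y"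
  shows "r [^] n \<preceq> x [^] n \<squnion> y"
proof (induction n)
  case 0
  show ?case by (simp add: join_ge1)
next
  case (Suc n)
  let ?u = "x [^] n"
  let ?w = "?u \<otimes> x \<squnion> y"
  note [simp] = closed
  have y_le: "y \<preceq> ?w" by (simp add: join_ge2)
  have "(?u \<squnion> y) \<otimes> (x \<squnion> y) \<preceq> ?w"
  proof (intro join_mult_leI mult_join_leI)
    show "?u \<otimes> x \<preceq> ?w" by (simp add: join_ge1)
    show "?u \<otimes> y \<preceq> ?w"
      using mult_neg_left[of y ?u] y_le le_trans[of "?u \<otimes> y" y ?w] by (simp add: neg pow_neg)
    show "y \<otimes> x \<preceq> ?w"
      using mult_neg_right[of y x] y_le le_trans[of "y \<otimes> x" y ?w] by (simp add: neg)
    show "y \<otimes> y \<preceq> ?w"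
      using mult_neg_right[of y y] y_le le_trans[of "y \<otimes> y" y ?w] by (simp add: neg)
  qed simp_all
  moreover have "r [^] n \<otimes> r \<preceq> (?u \<squnion> y) \<otimes> (x \<squnion> y)" by (simp add: mult_mono Suc r)
  ultimately show ?case using le_trans[of "r [^] n \<otimes> r" "(?u \<squnion> y) \<otimes> (x \<squnion> y)" ?w] by simp
qed

lemma cancellative_imp_cyclic:
  assumes "monoid_cancel L" and [simp]: "x \<in> carrier L" "y \<in> carrier L" and xy: "x \<otimes> y \<preceq> \<one>"
  shows "y \<otimes> x \<preceq> \<one>"
proof -
  interpret monoid_cancel L by fact
  note [simp] = closed
  have "\<one> \<preceq> x \<setminus> x" by (simp add: ldiv_residual[symmetric] le_refl)
  then have "x \<preceq> x \<otimes> (x \<setminus> x)" using mult_left_mono[of \<one> "x \<setminus> x" x] by simp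
  then have "x \<otimes> (x \<setminus> x) = x \<otimes> \<one>" using le_antisym mult_ldiv_le by simp
  then have "x \<setminus> x = \<one>" by (rule l_cancel) simp_all
  moreover have "x \<otimes> (y \<otimes> x) \<preceq> x"
    using xy mult_neg_left[of x "x \<otimes> y"] by (simp add: m_assoc)
  ultimately show ?thesis using ldiv_residual[of x "y \<otimes> x" x] by simp
qed

end

section \<open>Filters of the negative cone\<close>

locale negative_filter = residuated_lattice L for L (structure) +
  fixes F
  assumes subset: "F \<subseteq> carrier L"
    and neg: "f \<in> F \<Longrightarrow> f \<preceq> \<one>"
    and one_in: "\<one> \<in> F"
    and mult_in: "\<lbrakk>f \<in> F; g \<in> F\<rbrakk> \<Longrightarrow> f \<otimes> g \<in> F"
    and up_in: "\<lbrakk>f \<in> F; y \<in> carrier L; f \<preceq> y; y \<preceq> \<one>\<rbrakk> \<Longrightarrow> y \<in> F"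
begin

lemma in_carrier [simp]: "f \<in> F \<Longrightarrow> f \<in> carrier L"
  using subset by blast

lemma pow_in: "f \<in> F \<Longrightarrow> f [^] (n::nat) \<in> F"
  by (induction n) (simp_all add: one_in mult_in)

lemma mult_le1: "\<lbrakk>f \<in> F; g \<in> F\<rbrakk> \<Longrightarrow> f \<otimes> g \<preceq> f"
  by (simp add: mult_neg_right neg)

lemma mult_le2: "\<lbrakk>f \<in> F; g \<in> F\<rbrakk> \<Longrightarrow> f \<otimes> g \<preceq> g"
  by (simp add: mult_neg_left neg)

text \<open>
  The elements bounded below by some \<open>f \<in> F\<close> and above by \<open>f \<setminus> \<one>\<close>: the convex
  subuniverse that \<open>F\<close> generates.
\<close>

definition hull :: "'a set"
  where "hull = {x \<in> carrier L. \<exists>f\<in>F. f \<preceq> x \<and> f \<otimes> x \<preceq> \<one>}"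

lemma F_in_hull:
  assumes "f \<in> F" shows "f \<in> hull"
  using assms mult_neg_neg[of f f] by (auto simp: hull_def neg intro!: bexI[of _ f] le_refl)

lemma neg_in_hull: "\<lbrakk>x \<in> hull; x \<preceq> \<one>\<rbrakk> \<Longrightarrow> x \<in> F"
  unfolding hull_def using up_in by blast

lemma hull_common_bound:
  assumes "x \<in> hull" "y \<in> hull"
  obtains f where "f \<in> F" "f \<preceq> x" "f \<otimes> x \<preceq> \<one>" "f \<preceq> y" "f \<otimes> y \<preceq> \<one>"
proof -
  obtain f g where *: "f \<in> F" "f \<preceq> x" "f \<otimes> x \<preceq> \<one>" "g \<in> F" "g \<preceq> y" "g \<otimes> y \<preceq> \<one>"
    "x \<in> carrier L" "y \<in> carrier L"
    using assms by (auto simp: hull_def)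
  have "f \<otimes> g \<preceq> x" using * mult_le1 le_trans[of "f \<otimes> g" f x] by simp
  moreover have "f \<otimes> g \<preceq> y" using * mult_le2 le_trans[of "f \<otimes> g" g y] by simp
  moreover have "(f \<otimes> g) \<otimes> x \<preceq> \<one>"
    using * mult_le1 mult_right_mono[of "f \<otimes> g" f x] le_trans[of "(f \<otimes> g) \<otimes> x" "f \<otimes> x" \<one>] by simp
  moreover have "(f \<otimes> g) \<otimes> y \<preceq> \<one>"
    using * mult_le2 mult_right_mono[of "f \<otimes> g" g y] le_trans[of "(f \<otimes> g) \<otimes> y" "g \<otimes> y" \<one>] by simp
  ultimately show ?thesis using that * mult_in by blast
qed

lemma hull_convex:
  assumes x: "x \<in> hull" and z: "z \<in> hull" and [simp]: "y \<in> carrier L" and "x \<preceq> y" "y \<preceq> z"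
  shows "y \<in> hull"
proof -
  obtain f where f: "f \<in> F" "f \<preceq> x" "f \<otimes> x \<preceq> \<one>" "f \<preceq> z" "f \<otimes> z \<preceq> \<one>"
    by (rule hull_common_bound[OF x z])
  have [simp]: "x \<in> carrier L" "z \<in> carrier L" using x z by (simp_all add: hull_def)
  have "f \<preceq> y" using f assms le_trans[of f x y] by simp
  moreover have "f \<otimes> y \<preceq> \<one>"
    using f assms mult_left_mono[of y z f] le_trans[of "f \<otimes> y" "f \<otimes> z" \<one>] by simp
  ultimately show ?thesis using f by (auto simp: hull_def)
qed

lemma hull_convex_subuniverse:
  assumes cyclic:
    "\<And>x y. \<lbrakk>x \<in> carrier L; y \<in> carrier L; x \<otimes> y \<preceq> \<one>\<rbrakk> \<Longrightarrow> y \<otimes> x \<preceq> \<one>"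
  shows "convex_subuniverse hull L"
proof -
  have ops: "x \<otimes> y \<in> hull \<and> x \<sqinter> y \<in> hull \<and> x \<squnion> y \<in> hull \<and> x \<setminus> y \<in> hull \<and> x \<oslash> y \<in> hull"
    if x: "x \<in> hull" and y: "y \<in> hull" for x y
  proof -
    have [simp]: "x \<in> carrier L" "y \<in> carrier L" using x y by (simp_all add: hull_def)
    note [simp] = closed
    obtain f where f: "f \<in> F" "f \<preceq> x" "f \<otimes> x \<preceq> \<one>" "f \<preceq> y" "f \<otimes> y \<preceq> \<one>"
      by (rule hull_common_bound[OF x y])
    have [simp]: "f \<in> carrier L" and fneg: "f \<preceq> \<one>" using f neg by auto
    have ff: "f \<otimes> f \<in> F" using f mult_in by simp
    have xf: "x \<otimes> f \<preceq> \<one>" and yf: "y \<otimes> f \<preceq> \<one>" using f cyclic by simp_all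
    have "x \<otimes> y \<in> hull"
    proof -
      have "f \<otimes> f \<preceq> x \<otimes> y" using f by (simp add: mult_mono)
      moreover have "(f \<otimes> f) \<otimes> (x \<otimes> y) \<preceq> \<one>"
      proof -
        have "(f \<otimes> x) \<otimes> y \<preceq> y" using f by (simp add: mult_neg_left)
        then have "f \<otimes> ((f \<otimes> x) \<otimes> y) \<preceq> f \<otimes> y" by (simp add: mult_left_mono)
        then show ?thesis
          using f le_trans[of "f \<otimes> ((f \<otimes> x) \<otimes> y)" "f \<otimes> y" \<one>] by (simp add: m_assoc)
      qed
      ultimately show ?thesis using ff by (auto simp: hull_def)
    qed
    moreover have "x \<sqinter> y \<in> hull"
    proof -
      have "f \<preceq> x \<sqinter> y" using f by (simp add: le_meetI)
      moreover have "f \<otimes> (x \<sqinter> y) \<preceq> \<one>"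
        using f mult_left_mono[of "x \<sqinter> y" x f] meet_le1
          le_trans[of "f \<otimes> (x \<sqinter> y)" "f \<otimes> x" \<one>] by simp
      ultimately show ?thesis using f by (auto simp: hull_def)
    qed
    moreover have "x \<squnion> y \<in> hull"
    proof -
      have "f \<preceq> x \<squnion> y" using f join_ge1 le_trans[of f x "x \<squnion> y"] by simp
      moreover have "f \<otimes> (x \<squnion> y) \<preceq> \<one>" using f by (simp add: mult_join_leI)
      ultimately show ?thesis using f by (auto simp: hull_def)
    qed
    moreover have "x \<setminus> y \<in> hull"
    proof -
      have "(x \<otimes> f) \<otimes> f \<preceq> f" using xf by (simp add: mult_neg_left)
      then have "x \<otimes> (f \<otimes> f) \<preceq> y"
        using f le_trans[of "(x \<otimes> f) \<otimes> f" f y] by (simp add: m_assoc)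
      then have "f \<otimes> f \<preceq> x \<setminus> y" by (simp add: ldiv_residual)
      moreover have "(f \<otimes> f) \<otimes> (x \<setminus> y) \<preceq> \<one>"
      proof -
        have "f \<otimes> (x \<setminus> y) \<preceq> x \<otimes> (x \<setminus> y)" using f by (simp add: mult_right_mono)
        then have "f \<otimes> (x \<setminus> y) \<preceq> y"
          using mult_ldiv_le le_trans[of "f \<otimes> (x \<setminus> y)" "x \<otimes> (x \<setminus> y)" y] by simp
        then have "f \<otimes> (f \<otimes> (x \<setminus> y)) \<preceq> f \<otimes> y" by (simp add: mult_left_mono)
        then show ?thesis
          using f le_trans[of "f \<otimes> (f \<otimes> (x \<setminus> y))" "f \<otimes> y" \<one>] by (simp add: m_assoc)
      qed
      ultimately show ?thesis using ff by (auto simp: hull_def)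
    qed
    moreover have "x \<oslash> y \<in> hull"
    proof -
      have "f \<otimes> (f \<otimes> y) \<preceq> f" using f by (simp add: mult_neg_right)
      then have "(f \<otimes> f) \<otimes> y \<preceq> x"
        using f le_trans[of "f \<otimes> (f \<otimes> y)" f x] by (simp add: m_assoc)
      then have "f \<otimes> f \<preceq> x \<oslash> y" by (simp add: rdiv_residual)
      moreover have "(f \<otimes> f) \<otimes> (x \<oslash> y) \<preceq> \<one>"
      proof -
        have "(x \<oslash> y) \<otimes> f \<preceq> (x \<oslash> y) \<otimes> y" using f by (simp add: mult_left_mono)
        then have "(x \<oslash> y) \<otimes> f \<preceq> x"
          using rdiv_mult_le le_trans[of "(x \<oslash> y) \<otimes> f" "(x \<oslash> y) \<otimes> y" x] by simp
        then have "((x \<oslash> y) \<otimes> f) \<otimes> f \<preceq> x \<otimes> f" by (simp add: mult_right_mono)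
        then have "(x \<oslash> y) \<otimes> (f \<otimes> f) \<preceq> \<one>"
          using xf le_trans[of "((x \<oslash> y) \<otimes> f) \<otimes> f" "x \<otimes> f" \<one>] by (simp add: m_assoc)
        then show ?thesis by (simp add: cyclic)
      qed
      ultimately show ?thesis using ff by (auto simp: hull_def)
    qed
    ultimately show ?thesis by blast
  qed
  have "hull \<subseteq> carrier L" by (auto simp: hull_def)
  then have "subuniverse hull L"
    unfolding subuniverse_def using F_in_hull[OF one_in] ops by blast
  then show ?thesis unfolding convex_subuniverse_def using hull_convex by blast
qed

end

text \<open>Conjugates of elements of \<open>F\<close> lie in its hull and are negative, hence lie in \<open>F\<close>.\<close>

lemma (in negative_filter) hamiltonian_conj_in:
  assumes "monoid_cancel L" "hamiltonian L" and f: "f \<in> F" and b: "b \<in> carrier L"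
  shows "lconj L b f \<in> F" "rconj L b f \<in> F"
proof -
  have "normal_subuniverse hull L"
    using assms(2) hull_convex_subuniverse[OF cancellative_imp_cyclic[OF assms(1)]]
    by (simp add: hamiltonian_def)
  then have "lconj L b f \<in> hull" "rconj L b f \<in> hull"
    using F_in_hull[OF f] b by (simp_all add: normal_subuniverse_def)
  moreover have "lconj L b f \<preceq> \<one>" "rconj L b f \<preceq> \<one>"
    using f b by (simp_all add: lconj_def rconj_def closed meet_le2)
  ultimately show "lconj L b f \<in> F" "rconj L b f \<in> F" by (simp_all add: neg_in_hull)
qed

section \<open>Prime filters\<close>

definition prime_filter :: "('a, 'm) rlat_scheme \<Rightarrow> 'a set \<Rightarrow> bool"
  where "prime_filter L F \<longleftrightarrow> negative_filter L F \<and>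
    (\<forall>c\<in>carrier L. \<forall>d\<in>carrier L. c \<squnion>\<^bsub>L\<^esub> d = \<one>\<^bsub>L\<^esub> \<longrightarrow> c \<in> F \<or> d \<in> F)"

context negative_filter
begin

text \<open>The filter generated by \<open>F\<close> and a negative element \<open>c\<close>.\<close>

definition adjoin :: "'a \<Rightarrow> 'a set"
  where "adjoin c = {y \<in> carrier L. y \<preceq> \<one> \<and> (\<exists>p\<in>F. \<exists>n::nat. (p \<otimes> c) [^] n \<preceq> y)}"

lemma adjoin_filter:
  assumes [simp]: "c \<in> carrier L" shows "negative_filter L (adjoin c)"
proof unfold_locales
  show "adjoin c \<subseteq> carrier L" by (auto simp: adjoin_def)
  show "f \<preceq> \<one>" if "f \<in> adjoin c" for f using that by (simp add: adjoin_def)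
  have "(\<one> \<otimes> c) [^] (0::nat) \<preceq> \<one>" by (simp add: le_refl)
  then show "\<one> \<in> adjoin c" unfolding adjoin_def using one_in by (blast intro: le_refl)
next
  fix x y assume "x \<in> adjoin c" "y \<in> adjoin c"
  then obtain p q and n m :: nat where *: "p \<in> F" "q \<in> F" "(p \<otimes> c) [^] n \<preceq> x" "(q \<otimes> c) [^] m \<preceq> y"
    "x \<preceq> \<one>" "y \<preceq> \<one>" and [simp]: "x \<in> carrier L" "y \<in> carrier L"
    by (auto simp: adjoin_def)
  have [simp]: "p \<in> carrier L" "q \<in> carrier L" using * by simp_all
  let ?r = "(p \<otimes> q) \<otimes> c"
  have "?r \<preceq> p \<otimes> c" "?r \<preceq> q \<otimes> c"
    using * by (auto intro!: mult_right_mono mult_le1 mult_le2)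
  then have "?r [^] n \<preceq> (p \<otimes> c) [^] n" "?r [^] m \<preceq> (q \<otimes> c) [^] m" by (simp_all add: pow_mono)
  then have "?r [^] n \<preceq> x" "?r [^] m \<preceq> y"
    using * le_trans[of "?r [^] n" "(p \<otimes> c) [^] n" x] le_trans[of "?r [^] m" "(q \<otimes> c) [^] m" y]
    by simp_all
  then have "?r [^] (n + m) \<preceq> x \<otimes> y" by (simp add: nat_pow_mult[symmetric] mult_mono)
  moreover have "p \<otimes> q \<in> F" using * mult_in by blast
  moreover have "x \<otimes> y \<preceq> \<one>" using * by (simp add: mult_neg_neg)
  ultimately show "x \<otimes> y \<in> adjoin c" unfolding adjoin_def by (auto intro!: bexI)
next
  fix x y assume "x \<in> adjoin c" and y: "y \<in> carrier L" "x \<preceq> y" "y \<preceq> \<one>"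
  then obtain p and n :: nat where *: "p \<in> F" "(p \<otimes> c) [^] n \<preceq> x" "x \<in> carrier L"
    by (auto simp: adjoin_def)
  then have "(p \<otimes> c) [^] n \<preceq> y" using y le_trans[of "(p \<otimes> c) [^] n" x y] by simp
  then show "y \<in> adjoin c" using y * by (auto simp: adjoin_def)
qed

lemma adjoin_extends:
  assumes [simp]: "c \<in> carrier L" and c: "c \<preceq> \<one>"
  shows "F \<subseteq> adjoin c" "c \<in> adjoin c"
proof
  fix p assume p: "p \<in> F"
  have "(p \<otimes> c) [^] (1::nat) \<preceq> p" using p c by (simp add: mult_neg_right)
  then show "p \<in> adjoin c" unfolding adjoin_def using p neg in_carrier by blast
next
  have "(\<one> \<otimes> c) [^] (1::nat) \<preceq> c" by (simp add: le_refl)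
  then show "c \<in> adjoin c" unfolding adjoin_def using assms one_in by blast
qed

text \<open>
  With \<open>r = p \<otimes> q\<close>, an element above both \<open>(p \<otimes> c)\<^sup>n\<close> and \<open>(q \<otimes> d)\<^sup>m\<close> is above the join of
  \<open>(r \<otimes> c)\<^sup>n\<close> and \<open>(r \<otimes> d)\<^sup>m\<close>.  As \<open>(r \<otimes> c) \<squnion> (r \<otimes> d) = r \<otimes> (c \<squnion> d) = r\<close>, two applications of
  \<open>pow_le_pow_join\<close> put it above a power of \<open>r \<in> F\<close>.
\<close>

lemma adjoin_Int_adjoin:
  assumes [simp]: "c \<in> carrier L" "d \<in> carrier L" and cd: "c \<squnion> d = \<one>"
  shows "adjoin c \<inter> adjoin d \<subseteq> F"
proof
  fix a assume "a \<in> adjoin c \<inter> adjoin d"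
  then obtain p q and n m :: nat where *: "p \<in> F" "q \<in> F" "(p \<otimes> c) [^] n \<preceq> a" "(q \<otimes> d) [^] m \<preceq> a"
    and a: "a \<preceq> \<one>" and [simp]: "a \<in> carrier L"
    by (auto simp: adjoin_def)
  have [simp]: "p \<in> carrier L" "q \<in> carrier L" using * by simp_all
  note [simp] = closed
  define r where "r = p \<otimes> q"
  have r: "r \<in> F" unfolding r_def using * mult_in by blast
  then have [simp]: "r \<in> carrier L" by simp
  have "r \<otimes> c \<preceq> p \<otimes> c" "r \<otimes> d \<preceq> q \<otimes> d"
    unfolding r_def using * by (auto intro!: mult_right_mono mult_le1 mult_le2)
  then have le_a: "(r \<otimes> c) [^] n \<preceq> a" "(r \<otimes> d) [^] m \<preceq> a"
    using * pow_mono[of "r \<otimes> c" "p \<otimes> c" n] pow_mono[of "r \<otimes> d" "q \<otimes> d" m]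
      le_trans[of "(r \<otimes> c) [^] n" "(p \<otimes> c) [^] n" a]
      le_trans[of "(r \<otimes> d) [^] m" "(q \<otimes> d) [^] m" a] by simp_all
  have "c \<preceq> \<one>" "d \<preceq> \<one>" using join_ge1[of c d] join_ge2[of c d] cd by simp_all
  then have neg': "r \<otimes> c \<preceq> \<one>" "r \<otimes> d \<preceq> \<one>" using r neg by (simp_all add: mult_neg_neg)
  have "r \<otimes> (c \<squnion> d) \<preceq> r \<otimes> c \<squnion> r \<otimes> d"
    by (intro mult_join_leI) (simp_all add: join_ge1 join_ge2)
  then have "r [^] n \<preceq> (r \<otimes> c) [^] n \<squnion> r \<otimes> d"
    using neg' pow_le_pow_join[of "r \<otimes> c" "r \<otimes> d" r n] cd by simp
  then have "(r [^] n) [^] m \<preceq> (r \<otimes> d) [^] m \<squnion> (r \<otimes> c) [^] n"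
    using neg' pow_le_pow_join[of "r \<otimes> d" "(r \<otimes> c) [^] n" "r [^] n" m]
    by (simp add: pow_neg join_comm)
  moreover have "(r \<otimes> d) [^] m \<squnion> (r \<otimes> c) [^] n \<preceq> a" using le_a by (simp add: join_leI)
  ultimately have "(r [^] n) [^] m \<preceq> a"
    using le_trans[of "(r [^] n) [^] m" "(r \<otimes> d) [^] m \<squnion> (r \<otimes> c) [^] n" a] by simp
  then show "a \<in> F" using up_in[OF pow_in[OF pow_in[OF r]]] a by simp
qed

end

context residuated_lattice
begin

lemma filter_Union_chain:
  assumes "C \<noteq> {}" and chain: "subset.chain {F. negative_filter L F \<and> a \<notin> F} C"
  shows "negative_filter L (\<Union>C) \<and> a \<notin> \<Union>C"
proof
  have fil: "negative_filter L F" "a \<notin> F" if "F \<in> C" for F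
    using chain that by (auto simp: subset_chain_def)
  show "a \<notin> \<Union>C" using fil by blast
  show "negative_filter L (\<Union>C)"
  proof unfold_locales
    show "\<Union>C \<subseteq> carrier L" using negative_filter.subset[OF fil(1)] by blast
    show "f \<preceq> \<one>" if "f \<in> \<Union>C" for f using that negative_filter.neg[OF fil(1)] by blast
    show "\<one> \<in> \<Union>C" using \<open>C \<noteq> {}\<close> negative_filter.one_in[OF fil(1)] by blast
    show "y \<in> \<Union>C" if "f \<in> \<Union>C" "y \<in> carrier L" "f \<preceq> y" "y \<preceq> \<one>" for f y
      using that negative_filter.up_in[OF fil(1)] by blast
  next
    fix f g assume "f \<in> \<Union>C" "g \<in> \<Union>C"
    then obtain F G where FG: "F \<in> C" "f \<in> F" "G \<in> C" "g \<in> G" by blast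
    then have "F \<subseteq> G \<or> G \<subseteq> F" using chain by (auto simp: subset_chain_def)
    then show "f \<otimes> g \<in> \<Union>C" using FG negative_filter.mult_in[OF fil(1)] by blast
  qed
qed

text \<open>
  A filter maximal among those avoiding \<open>a\<close> is prime: if it contained neither \<open>c\<close> nor \<open>d\<close>,
  adjoining either of them would bring in \<open>a\<close>, contradicting \<open>adjoin_Int_adjoin\<close>.
\<close>

lemma prime_filter_avoiding:
  assumes "a \<noteq> \<one>"
  obtains F where "prime_filter L F" "a \<notin> F"
proof -
  let ?A = "{F. negative_filter L F \<and> a \<notin> F}"
  have "negative_filter L {\<one>}"
    by unfold_locales (auto simp: le_refl intro: le_antisym)
  then have "?A \<noteq> {}" using assms by blast
  then have "\<exists>F\<in>?A. \<forall>X\<in>?A. F \<subseteq> X \<longrightarrow> X = F"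
    by (rule subset_Zorn_nonempty) (use filter_Union_chain in blast)
  then obtain F where F: "negative_filter L F" "a \<notin> F"
    and max: "\<And>X. \<lbrakk>negative_filter L X; a \<notin> X; F \<subseteq> X\<rbrakk> \<Longrightarrow> X = F" by blast
  interpret negative_filter L F by fact
  have gen: "a \<in> adjoin c" if "c \<in> carrier L" "c \<preceq> \<one>" "c \<notin> F" for c
    using max[OF adjoin_filter] adjoin_extends that by blast
  have "c \<in> F \<or> d \<in> F" if "c \<in> carrier L" "d \<in> carrier L" "c \<squnion> d = \<one>" for c d
  proof -
    have "c \<preceq> \<one>" "d \<preceq> \<one>" using that join_ge1[of c d] join_ge2[of c d] by simp_all
    then show ?thesis using gen[of c] gen[of d] adjoin_Int_adjoin[of c d] that F(2) by blast
  qed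
  then have "prime_filter L F" unfolding prime_filter_def using F(1) by blast
  then show ?thesis using that F(2) by blast
qed

end

section \<open>The quotient by a normal filter\<close>

locale normal_filter = negative_filter +
  assumes lconj_in: "\<lbrakk>f \<in> F; b \<in> carrier L\<rbrakk> \<Longrightarrow> lconj L b f \<in> F"
    and rconj_in: "\<lbrakk>f \<in> F; b \<in> carrier L\<rbrakk> \<Longrightarrow> rconj L b f \<in> F"
begin

definition fle :: "'a \<Rightarrow> 'a \<Rightarrow> bool"
  where "fle x y \<longleftrightarrow> (\<exists>f\<in>F. x \<otimes> f \<preceq> y)"

text \<open>
  The conjugate \<open>g = rconj L x f\<close> satisfies \<open>g \<otimes> x \<preceq> x \<otimes> f\<close>, and \<open>lconj\<close> works
  symmetrically; so it does not matter on which side the element of \<open>F\<close> is multiplied.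
\<close>

lemma fle_iff_left:
  assumes [simp]: "x \<in> carrier L" "y \<in> carrier L"
  shows "fle x y \<longleftrightarrow> (\<exists>f\<in>F. f \<otimes> x \<preceq> y)"
proof
  note [simp] = closed
  assume "fle x y"
  then obtain f where f: "f \<in> F" "x \<otimes> f \<preceq> y" by (auto simp: fle_def)
  let ?g = "rconj L x f"
  have "?g \<preceq> (x \<otimes> f) \<oslash> x" unfolding rconj_def using f by (simp add: meet_le1)
  then have "?g \<otimes> x \<preceq> x \<otimes> f" using f rconj_in[of f x] by (simp add: rdiv_residual)
  then have "?g \<otimes> x \<preceq> y"
    using f rconj_in[of f x] le_trans[of "?g \<otimes> x" "x \<otimes> f" y] by simp
  then show "\<exists>f\<in>F. f \<otimes> x \<preceq> y" using f rconj_in[of f x] by auto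
next
  note [simp] = closed
  assume "\<exists>f\<in>F. f \<otimes> x \<preceq> y"
  then obtain f where f: "f \<in> F" "f \<otimes> x \<preceq> y" by blast
  let ?g = "lconj L x f"
  have "?g \<preceq> x \<setminus> (f \<otimes> x)" unfolding lconj_def using f by (simp add: meet_le1)
  then have "x \<otimes> ?g \<preceq> f \<otimes> x" using f lconj_in[of f x] by (simp add: ldiv_residual)
  then have "x \<otimes> ?g \<preceq> y"
    using f lconj_in[of f x] le_trans[of "x \<otimes> ?g" "f \<otimes> x" y] by simp
  then show "fle x y" using f lconj_in[of f x] by (auto simp: fle_def)
qed

lemma le_imp_fle: "\<lbrakk>x \<in> carrier L; y \<in> carrier L; x \<preceq> y\<rbrakk> \<Longrightarrow> fle x y"
  unfolding fle_def using one_in r_one by metis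

lemma fle_refl: "x \<in> carrier L \<Longrightarrow> fle x x"
  by (simp add: le_imp_fle le_refl)

lemma fle_trans:
  assumes [simp]: "x \<in> carrier L" "y \<in> carrier L" "z \<in> carrier L" and "fle x y" "fle y z"
  shows "fle x z"
proof -
  obtain f g where *: "f \<in> F" "g \<in> F" "x \<otimes> f \<preceq> y" "y \<otimes> g \<preceq> z" using assms by (auto simp: fle_def)
  have "x \<otimes> (f \<otimes> g) \<preceq> z"
    using * mult_right_mono[of "x \<otimes> f" y g] le_trans[of "(x \<otimes> f) \<otimes> g" "y \<otimes> g" z]
    by (simp add: m_assoc)
  then show ?thesis using * mult_in by (auto simp: fle_def)
qed

lemma fle_mult_left:
  assumes "x \<in> carrier L" "y \<in> carrier L" "z \<in> carrier L" "fle x y"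
  shows "fle (z \<otimes> x) (z \<otimes> y)"
proof -
  obtain f where "f \<in> F" "x \<otimes> f \<preceq> y" using assms by (auto simp: fle_def)
  then have "(z \<otimes> x) \<otimes> f \<preceq> z \<otimes> y" using assms by (simp add: m_assoc mult_left_mono)
  then show ?thesis using \<open>f \<in> F\<close> by (auto simp: fle_def)
qed

lemma fle_mult_right:
  assumes "x \<in> carrier L" "y \<in> carrier L" "z \<in> carrier L" "fle x y"
  shows "fle (x \<otimes> z) (y \<otimes> z)"
proof -
  obtain f where "f \<in> F" "f \<otimes> x \<preceq> y" using assms by (auto simp: fle_iff_left)
  then have "f \<otimes> (x \<otimes> z) \<preceq> y \<otimes> z" using assms by (simp add: m_assoc[symmetric] mult_right_mono)
  then show ?thesis using \<open>f \<in> F\<close> assms by (auto simp: fle_iff_left)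
qed

lemma fle_ldiv_residual:
  assumes "x \<in> carrier L" "y \<in> carrier L" "z \<in> carrier L"
  shows "fle (x \<otimes> y) z \<longleftrightarrow> fle y (x \<setminus> z)"
  using assms by (auto simp: fle_def m_assoc ldiv_residual closed)

lemma fle_rdiv_residual:
  assumes "x \<in> carrier L" "y \<in> carrier L" "z \<in> carrier L"
  shows "fle (x \<otimes> y) z \<longleftrightarrow> fle x (z \<oslash> y)"
  using assms by (auto simp: fle_iff_left m_assoc[symmetric] rdiv_residual closed)

lemma fle_meetI:
  assumes [simp]: "x \<in> carrier L" "y \<in> carrier L" "z \<in> carrier L" and "fle z x" "fle z y"
  shows "fle z (x \<sqinter> y)"
proof -
  obtain f g where *: "f \<in> F" "g \<in> F" "z \<otimes> f \<preceq> x" "z \<otimes> g \<preceq> y" using assms by (auto simp: fle_def)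
  have "z \<otimes> (f \<otimes> g) \<preceq> z \<otimes> f" "z \<otimes> (f \<otimes> g) \<preceq> z \<otimes> g"
    using * by (simp_all add: mult_left_mono mult_le1 mult_le2)
  then have "z \<otimes> (f \<otimes> g) \<preceq> x \<sqinter> y"
    using * le_trans[of "z \<otimes> (f \<otimes> g)" "z \<otimes> f" x] le_trans[of "z \<otimes> (f \<otimes> g)" "z \<otimes> g" y]
    by (simp add: le_meetI)
  then show ?thesis using * mult_in by (auto simp: fle_def)
qed

lemma fle_joinI:
  assumes [simp]: "x \<in> carrier L" "y \<in> carrier L" "z \<in> carrier L" and "fle x z" "fle y z"
  shows "fle (x \<squnion> y) z"
proof -
  obtain f g where *: "f \<in> F" "g \<in> F" "x \<otimes> f \<preceq> z" "y \<otimes> g \<preceq> z" using assms by (auto simp: fle_def)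
  have "x \<otimes> (f \<otimes> g) \<preceq> x \<otimes> f" "y \<otimes> (f \<otimes> g) \<preceq> y \<otimes> g"
    using * by (simp_all add: mult_left_mono mult_le1 mult_le2)
  then have "(x \<squnion> y) \<otimes> (f \<otimes> g) \<preceq> z"
    using * le_trans[of "x \<otimes> (f \<otimes> g)" "x \<otimes> f" z] le_trans[of "y \<otimes> (f \<otimes> g)" "y \<otimes> g" z]
    by (simp add: join_mult_leI)
  then show ?thesis using * mult_in by (auto simp: fle_def)
qed

text \<open>
  The meet, join and residuals of \<open>L\<close> satisfy, with respect to \<open>fle\<close>, the universal properties
  that determine them up to equivalence.  This yields their monotonicity, and with it the
  congruence property.
\<close>

lemma fle_mono:
  assumes [simp]: "x \<in> carrier L" "x' \<in> carrier L" "y \<in> carrier L" "y' \<in> carrier L"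
    and y: "fle y y'"
  shows "fle x x' \<Longrightarrow> fle (x \<otimes> y) (x' \<otimes> y')"
    and "fle x x' \<Longrightarrow> fle (x \<sqinter> y) (x' \<sqinter> y')"
    and "fle x x' \<Longrightarrow> fle (x \<squnion> y) (x' \<squnion> y')"
    and "fle x' x \<Longrightarrow> fle (x \<setminus> y) (x' \<setminus> y')"
    and "fle x' x \<Longrightarrow> fle (y \<oslash> x) (y' \<oslash> x')"
proof -
  note [simp] = closed
  have le: "fle (x \<sqinter> y) x" "fle (x \<sqinter> y) y" "fle x' (x' \<squnion> y')" "fle y' (x' \<squnion> y')"
    "fle (x \<otimes> (x \<setminus> y)) y" "fle ((y \<oslash> x) \<otimes> x) y"
    by (simp_all add: le_imp_fle meet_le1 meet_le2 join_ge1 join_ge2 mult_ldiv_le rdiv_mult_le)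
  {
    assume x: "fle x x'"
    show "fle (x \<otimes> y) (x' \<otimes> y')"
      using fle_trans[of "x \<otimes> y" "x' \<otimes> y" "x' \<otimes> y'"] x y
      by (simp add: fle_mult_left fle_mult_right)
    show "fle (x \<sqinter> y) (x' \<sqinter> y')"
      using fle_trans[OF _ _ _ le(1) x] fle_trans[OF _ _ _ le(2) y] by (simp add: fle_meetI)
    show "fle (x \<squnion> y) (x' \<squnion> y')"
      using fle_trans[OF _ _ _ x le(3)] fle_trans[OF _ _ _ y le(4)] by (simp add: fle_joinI)
  next
    assume x: "fle x' x"
    have "fle (x \<otimes> (x \<setminus> y)) y'" using fle_trans[OF _ _ _ le(5) y] by simp
    then have "fle (x' \<otimes> (x \<setminus> y)) y'"
      using fle_trans[of "x' \<otimes> (x \<setminus> y)" "x \<otimes> (x \<setminus> y)" y'] x by (simp add: fle_mult_right)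
    then show "fle (x \<setminus> y) (x' \<setminus> y')" by (simp add: fle_ldiv_residual)
    have "fle ((y \<oslash> x) \<otimes> x) y'" using fle_trans[OF _ _ _ le(6) y] by simp
    then have "fle ((y \<oslash> x) \<otimes> x') y'"
      using fle_trans[of "(y \<oslash> x) \<otimes> x'" "(y \<oslash> x) \<otimes> x" y'] x by (simp add: fle_mult_left)
    then show "fle (y \<oslash> x) (y' \<oslash> x')" by (simp add: fle_rdiv_residual)
  }
qed

definition cls :: "'a \<Rightarrow> 'a set"
  where "cls x = {y \<in> carrier L. fle x y \<and> fle y x}"

definition rep :: "'a set \<Rightarrow> 'a"
  where "rep = inv_into (carrier L) cls"

definition quotient :: "'a set rlat"
  where "quotient = \<lparr>
    carrier = cls ` carrier L,
    monoid.mult = (\<lambda>A B. cls (rep A \<otimes> rep B)),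
    one = cls \<one>,
    rl_meet = (\<lambda>A B. cls (rep A \<sqinter> rep B)),
    rl_join = (\<lambda>A B. cls (rep A \<squnion> rep B)),
    ldiv = (\<lambda>A B. cls (rep A \<setminus> rep B)),
    rdiv = (\<lambda>A B. cls (rep A \<oslash> rep B))\<rparr>"

lemma cls_eq_iff:
  assumes "x \<in> carrier L" "y \<in> carrier L"
  shows "cls x = cls y \<longleftrightarrow> fle x y \<and> fle y x"
proof
  assume "cls x = cls y"
  then have "y \<in> cls x" using assms by (simp add: cls_def fle_refl)
  then show "fle x y \<and> fle y x" by (simp add: cls_def)
next
  assume "fle x y \<and> fle y x"
  then show "cls x = cls y" using assms by (auto simp: cls_def intro: fle_trans)
qed

lemma rep_cls:
  assumes "x \<in> carrier L"
  shows "rep (cls x) \<in> carrier L" "fle (rep (cls x)) x" "fle x (rep (cls x))"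
proof -
  have *: "cls x \<in> cls ` carrier L" using assms by blast
  show "rep (cls x) \<in> carrier L" unfolding rep_def by (rule inv_into_into[OF *])
  moreover have "cls (rep (cls x)) = cls x" unfolding rep_def by (rule f_inv_into_f[OF *])
  ultimately show "fle (rep (cls x)) x" "fle x (rep (cls x))"
    using assms by (simp_all add: cls_eq_iff)
qed

lemma quotient_carrier: "carrier quotient = cls ` carrier L"
  by (simp add: quotient_def)

lemma quotient_one: "\<one>\<^bsub>quotient\<^esub> = cls \<one>"
  by (simp add: quotient_def)

lemma quotient_op:
  assumes "x \<in> carrier L" "y \<in> carrier L"
  shows "cls x \<otimes>\<^bsub>quotient\<^esub> cls y = cls (x \<otimes> y)"
    "cls x \<sqinter>\<^bsub>quotient\<^esub> cls y = cls (x \<sqinter> y)"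
    "cls x \<squnion>\<^bsub>quotient\<^esub> cls y = cls (x \<squnion> y)"
    "cls x \<setminus>\<^bsub>quotient\<^esub> cls y = cls (x \<setminus> y)"
    "cls x \<oslash>\<^bsub>quotient\<^esub> cls y = cls (x \<oslash> y)"
  using assms by (simp_all add: quotient_def cls_eq_iff rep_cls closed fle_mono)

lemma quotient_le:
  assumes "x \<in> carrier L" "y \<in> carrier L"
  shows "cls x \<preceq>\<^bsub>quotient\<^esub> cls y \<longleftrightarrow> fle x y"
proof -
  have "cls x \<preceq>\<^bsub>quotient\<^esub> cls y \<longleftrightarrow> fle (x \<sqinter> y) x \<and> fle x (x \<sqinter> y)"
    using assms by (simp add: rl_le_def quotient_op cls_eq_iff closed)
  also have "\<dots> \<longleftrightarrow> fle x y"
    using assms fle_trans[of x "x \<sqinter> y" y]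
    by (auto simp: closed le_imp_fle meet_le1 meet_le2 fle_meetI fle_refl)
  finally show ?thesis .
qed

lemma quotient_residuated_lattice: "residuated_lattice quotient"
proof (unfold_locales, goal_cases)
  case (10 a b)
  then show ?case by (clarsimp simp: quotient_carrier quotient_op) (metis meet_comm)
next
  case (11 a b)
  then show ?case by (clarsimp simp: quotient_carrier quotient_op) (metis join_comm)
next
  case (16 a b d)
  then show ?case
    by (auto simp: quotient_carrier quotient_op quotient_le closed fle_rdiv_residual)
next
  case (17 a b d)
  then show ?case
    by (auto simp: quotient_carrier quotient_op quotient_le closed fle_ldiv_residual)
qed (auto simp: quotient_carrier quotient_one quotient_op closed m_assoc meet_assoc join_assoc
      meet_absorb join_absorb)

lemma fle_total:
  assumes "prelinear L" "prime_filter L F" and [simp]: "x \<in> carrier L" "y \<in> carrier L"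
  shows "fle x y \<or> fle y x"
proof -
  note [simp] = closed
  have *: "fle u v" if "(u \<setminus> v) \<sqinter> \<one> \<in> F" and [simp]: "u \<in> carrier L" "v \<in> carrier L" for u v
  proof -
    have "u \<otimes> ((u \<setminus> v) \<sqinter> \<one>) \<preceq> v" by (simp add: ldiv_residual meet_le1)
    then show ?thesis using that by (auto simp: fle_def)
  qed
  have "((x \<setminus> y) \<sqinter> \<one>) \<squnion> ((y \<setminus> x) \<sqinter> \<one>) = \<one>" using assms(1) by (simp add: prelinear_def)
  then have "(x \<setminus> y) \<sqinter> \<one> \<in> F \<or> (y \<setminus> x) \<sqinter> \<one> \<in> F"
    using assms(2) by (simp add: prime_filter_def)
  then show ?thesis using * by auto
qed

lemma quotient_totally_ordered:
  assumes "prelinear L" "prime_filter L F"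
  shows "totally_ordered_rl quotient"
  unfolding totally_ordered_rl_def using fle_total[OF assms]
  by (auto simp: quotient_residuated_lattice quotient_carrier quotient_le)

end

section \<open>Subdirect representation\<close>

text \<open>
  Homomorphisms onto chains that jointly separate points assemble into an isomorphism with a
  subdirect product.
\<close>

lemma semilinear_if_separated:
  fixes L :: "('a, 'm) rlat_scheme" and M :: "'i \<Rightarrow> 'b rlat"
  assumes L: "residuated_lattice L"
    and M: "\<And>i. i \<in> I \<Longrightarrow> totally_ordered_rl (M i)"
    and hom: "\<And>i. i \<in> I \<Longrightarrow> h i \<in> rl_hom L (M i)"
    and onto: "\<And>i. i \<in> I \<Longrightarrow> h i ` carrier L = carrier (M i)"
    and sep: "\<And>x y. \<lbrakk>x \<in> carrier L; y \<in> carrier L; x \<noteq> y\<rbrakk> \<Longrightarrow> \<exists>i\<in>I. h i x \<noteq> h i y"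
  shows "semilinear L"
proof -
  interpret residuated_lattice L by fact
  let ?P = "product_rl I M"
  define e where "e x = (\<lambda>i\<in>I. h i x)" for x
  define S where "S = e ` carrier L"
  have h_one: "h i \<one>\<^bsub>L\<^esub> = \<one>\<^bsub>M i\<^esub>" if "i \<in> I" for i
    using hom[OF that] by (simp add: rl_hom_def)
  have h_op: "h i (x \<otimes>\<^bsub>L\<^esub> y) = h i x \<otimes>\<^bsub>M i\<^esub> h i y"
    "h i (x \<sqinter>\<^bsub>L\<^esub> y) = h i x \<sqinter>\<^bsub>M i\<^esub> h i y" "h i (x \<squnion>\<^bsub>L\<^esub> y) = h i x \<squnion>\<^bsub>M i\<^esub> h i y"
    "h i (x \<setminus>\<^bsub>L\<^esub> y) = h i x \<setminus>\<^bsub>M i\<^esub> h i y" "h i (x \<oslash>\<^bsub>L\<^esub> y) = h i x \<oslash>\<^bsub>M i\<^esub> h i y"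
    if "i \<in> I" "x \<in> carrier L" "y \<in> carrier L" for i x y
    using hom[OF that(1)] that(2,3) by (simp_all add: rl_hom_def hom_def)
  have e_one: "e \<one>\<^bsub>L\<^esub> = \<one>\<^bsub>?P\<^esub>"
    by (rule ext) (simp add: e_def product_rl_def h_one)
  have e_op: "e (x \<otimes>\<^bsub>L\<^esub> y) = e x \<otimes>\<^bsub>?P\<^esub> e y" "e (x \<sqinter>\<^bsub>L\<^esub> y) = e x \<sqinter>\<^bsub>?P\<^esub> e y"
    "e (x \<squnion>\<^bsub>L\<^esub> y) = e x \<squnion>\<^bsub>?P\<^esub> e y" "e (x \<setminus>\<^bsub>L\<^esub> y) = e x \<setminus>\<^bsub>?P\<^esub> e y"
    "e (x \<oslash>\<^bsub>L\<^esub> y) = e x \<oslash>\<^bsub>?P\<^esub> e y"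
    if "x \<in> carrier L" "y \<in> carrier L" for x y
    using that by (auto simp: e_def product_rl_def h_op fun_eq_iff restrict_def)
  have "h i x \<in> carrier (M i)" if "i \<in> I" "x \<in> carrier L" for i x
    using onto that by blast
  then have "S \<subseteq> carrier ?P" by (auto simp: S_def e_def product_rl_def)
  moreover have "\<one>\<^bsub>?P\<^esub> \<in> S" unfolding S_def e_one[symmetric] by simp
  moreover have "x \<otimes>\<^bsub>?P\<^esub> y \<in> S \<and> x \<sqinter>\<^bsub>?P\<^esub> y \<in> S \<and> x \<squnion>\<^bsub>?P\<^esub> y \<in> S \<and> x \<setminus>\<^bsub>?P\<^esub> y \<in> S \<and> x \<oslash>\<^bsub>?P\<^esub> y \<in> S"
    if "x \<in> S" "y \<in> S" for x y
    using that by (auto simp: S_def e_op[symmetric] closed)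
  ultimately have "subuniverse S ?P" by (simp add: subuniverse_def)
  moreover have "(\<lambda>x. x i) ` S = carrier (M i)" if "i \<in> I" for i
    using that onto by (simp add: S_def e_def image_image)
  ultimately have "is_subdirect S I M" by (simp add: is_subdirect_def)
  moreover have "inj_on e (carrier L)"
  proof (rule inj_onI, rule ccontr)
    fix x y assume *: "x \<in> carrier L" "y \<in> carrier L" "e x = e y" "x \<noteq> y"
    then obtain i where i: "i \<in> I" "h i x \<noteq> h i y" using sep by blast
    then show False using fun_cong[OF *(3), of i] by (simp add: e_def)
  qed
  moreover have "e \<in> rl_hom L (?P\<lparr>carrier := S\<rparr>)"
    using e_one e_op by (simp add: rl_hom_def hom_def S_def Pi_iff)
  ultimately have "represents L I M S"
    using M by (auto simp: represents_def rl_isomorphic_def bij_betw_def S_def)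
  then show ?thesis using semilinear_if_represented[OF L] by blast
qed

theorem corollary5p4:
  fixes L :: "('a, 'm) rlat_scheme"
  assumes "residuated_lattice L" and "monoid_cancel L"
    and "prelinear L" and "hamiltonian L"
  shows "semilinear L"
proof -
  interpret residuated_lattice L by fact
  have normal: "normal_filter L F" if "prime_filter L F" for F
  proof -
    interpret negative_filter L F using that by (simp add: prime_filter_def)
    show ?thesis by unfold_locales (simp_all add: hamiltonian_conj_in assms(2,4))
  qed
  have separated: "\<exists>F. prime_filter L F \<and> \<not> normal_filter.fle L F x y"
    if x: "x \<in> carrier L" and y: "y \<in> carrier L" and nle: "\<not> x \<preceq>\<^bsub>L\<^esub> y" for x y
  proof -
    let ?a = "(x \<setminus>\<^bsub>L\<^esub> y) \<sqinter>\<^bsub>L\<^esub> \<one>\<^bsub>L\<^esub>"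
    have "?a \<noteq> \<one>\<^bsub>L\<^esub>"
    proof
      assume "?a = \<one>\<^bsub>L\<^esub>"
      then have "\<one>\<^bsub>L\<^esub> \<preceq>\<^bsub>L\<^esub> x \<setminus>\<^bsub>L\<^esub> y" using x y meet_le1[of "x \<setminus>\<^bsub>L\<^esub> y" "\<one>\<^bsub>L\<^esub>"] by (simp add: closed)
      then show False using x y nle ldiv_residual[of x "\<one>\<^bsub>L\<^esub>" y] by simp
    qed
    then obtain F where F: "prime_filter L F" "?a \<notin> F" by (rule prime_filter_avoiding)
    interpret normal_filter L F using F normal by blast
    have "\<not> fle x y"
    proof
      assume "fle x y"
      then obtain f where f: "f \<in> F" "x \<otimes>\<^bsub>L\<^esub> f \<preceq>\<^bsub>L\<^esub> y" by (auto simp: fle_def)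
      then have "f \<preceq>\<^bsub>L\<^esub> ?a" using x y neg by (simp add: ldiv_residual le_meetI closed)
      then show False using F f x y up_in[of f ?a] by (simp add: closed meet_le2)
    qed
    then show ?thesis using F by blast
  qed
  let ?I = "{F. prime_filter L F}"
  show ?thesis
  proof (rule semilinear_if_separated[of L ?I "normal_filter.quotient L" "normal_filter.cls L"])
    show "residuated_lattice L" by fact
  next
    fix F assume "F \<in> ?I"
    then have F: "prime_filter L F" by simp
    interpret normal_filter L F using normal[OF F] .
    show "totally_ordered_rl quotient" by (rule quotient_totally_ordered) fact+
    show "cls \<in> rl_hom L quotient"
      by (simp add: rl_hom_def hom_def quotient_carrier quotient_one quotient_op)
    show "cls ` carrier L = carrier quotient" by (simp add: quotient_carrier)
  next
    fix x y assume xy: "x \<in> carrier L" "y \<in> carrier L" "x \<noteq> y"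
    then have "\<not> x \<preceq>\<^bsub>L\<^esub> y \<or> \<not> y \<preceq>\<^bsub>L\<^esub> x" using le_antisym by blast
    then obtain F where F: "prime_filter L F"
      "\<not> normal_filter.fle L F x y \<or> \<not> normal_filter.fle L F y x"
      using separated xy by blast
    have "normal_filter.cls L F x \<noteq> normal_filter.cls L F y"
      using F normal_filter.cls_eq_iff[OF normal[OF F(1)] xy(1,2)] by blast
    then show "\<exists>F\<in>?I. normal_filter.cls L F x \<noteq> normal_filter.cls L F y" using F by blast
  qed
qed

end
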